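(* Let $0<\mu_k<1$ for each $k\ge 2$. Let $\mathcal G=(\mathcal G_k)_{k\ge 2}$, where $\mathcal G_k$ is the property of a finite presentation on $k$ generators $a_1,\dots,a_k$ that all the defining relations are non-$\mu_k$-readable. Then $\mathcal G$ is not $d$-random for any $d>0$.
   Context: Let $\mathcal C_k$ be the set of all cyclically reduced words in the free group $F(a_1,\dots,a_k)$ and $\gamma(n,\mathcal C_k)$ the number of words of length $n$ in $\mathcal C_k$. For $0<d<1$ (independent of $k$), a property $\mathcal G=(\mathcal G_k)_{k\ge2}$ of finite presentations ($\mathcal G_k$ being a property of presentations on $a_1,\dots,a_k$) is $d$-random if for every $k\ge 2$ $$\lim_{n\to\infty}\frac{R_k(n,d,\mathcal G_k)}{\gamma(n,\mathcal C_k)^{m_n}}=1,$$ where $m_n=(2k-1)^{dn}$ (rounded down to an integer) and $R_k(n,d,\mathcal G_k)$ is the number of $m_n$-tuples $(r_1,\dots,r_{m_n})$ of cyclically reduced words of length $n$ such that $\langle a_1,\dots,a_k\mid r_1,\dots,r_{m_n}\rangle$ has property $\mathcal G_k$. Let $0<\mu<1$ and $k\ge2$. A freely reduced word $w$ in $F(a_1,\dots,a_k)$ is $\mu$-readable if there exists a finite connected graph $\Gamma$ with a distinguished base-vertex such that: (1) every oriented edge $e$ of $\Gamma$ is labelled by some $s(e)\in\{a_1,\dots,a_k\}^{\pm1}$ with $s(e^{-1})=s(e)^{-1}$; (2) $\Gamma$ is folded, that is, no vertex has two distinct edges originating at it with the same label; (3) $\Gamma$ has no degree-one vertices except possibly the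 base-vertex; (4) the fundamental group of $\Gamma$ is free of rank at most $k-1$; (5) there exists an immersed (i.e. without backtracking) path in $\Gamma$ labelled $w$; (6) the number of non-oriented edges of $\Gamma$ is at most $\mu|w|$. *)

theory Defs
  imports Complex_Main "HOL-Algebra.Group" "Graph_Theory.Graph_Theory"
begin

section \<open>Free reduction with respect to a formal inversion\<close>

text \<open>
  The letters of words in a free group and the oriented edges of a graph both carry a formal
  inversion \<open>bar\<close>. A list is \<^emph>\<open>reduced\<close> if no entry is immediately followed by its inverse, and
  \<open>reduce bar xs\<close> is the reduced list obtained from \<open>xs\<close> by deleting adjacent inverse pairs.
\<close>

definition reduced :: "('x \<Rightarrow> 'x) \<Rightarrow> 'x list \<Rightarrow> bool" where
  "reduced bar xs \<longleftrightarrow> successively (\<lambda>x y. y \<noteq> bar x) xs"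

fun cancel_cons :: "('x \<Rightarrow> 'x) \<Rightarrow> 'x \<Rightarrow> 'x list \<Rightarrow> 'x list" where
  "cancel_cons bar x [] = [x]"
| "cancel_cons bar x (y # ys) = (if y = bar x then ys else x # y # ys)"

definition reduce :: "('x \<Rightarrow> 'x) \<Rightarrow> 'x list \<Rightarrow> 'x list" where
  "reduce bar xs = foldr (cancel_cons bar) xs []"


section \<open>Words and free groups\<close>

text \<open>The letter \<open>(i, True)\<close> is the generator \<open>a\<^sub>i\<^sub>+\<^sub>1\<close>, and \<open>(i, False)\<close> is its formal inverse.\<close>

type_synonym letter = "nat \<times> bool"
type_synonym word = "letter list"

definition letters :: "nat \<Rightarrow> letter set" where
  "letters k = {..<k} \<times> UNIV"

fun letter_inv :: "letter \<Rightarrow> letter" where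
  "letter_inv (i, b) = (i, \<not> b)"

definition freely_reduced :: "nat \<Rightarrow> word set" where
  "freely_reduced k = {w \<in> lists (letters k). reduced letter_inv w}"

definition cyclically_reduced :: "nat \<Rightarrow> word set" where
  "cyclically_reduced k =
     {w \<in> freely_reduced k. w \<noteq> [] \<longrightarrow> hd w \<noteq> letter_inv (last w)}"

definition free_group :: "nat \<Rightarrow> word monoid" where
  "free_group k =
     \<lparr>carrier = freely_reduced k, monoid.mult = (\<lambda>u v. reduce letter_inv (u @ v)), monoid.one = []\<rparr>"

definition free_of_rank :: "('g, 'm) monoid_scheme \<Rightarrow> nat \<Rightarrow> bool" where
  "free_of_rank G r \<longleftrightarrow> free_group r \<cong> G"


section \<open>Graphs and their fundamental groups\<close>

text \<open>
  Graphs are finite bidirected digraphs: every arc is an oriented edge and \<open>arev\<close> is the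
  fixed-point-free involution \<open>e \<mapsto> e\<^sup>-\<^sup>1\<close> reversing orientation. Loops and multiple edges are allowed.
  The walks are the library's \<open>awalk\<close>s; an immersed path is a reduced one.
\<close>

definition immersed_path ::
    "('v, 'e) pre_digraph \<Rightarrow> ('e \<Rightarrow> 'e) \<Rightarrow> 'v \<Rightarrow> 'e list \<Rightarrow> 'v \<Rightarrow> bool" where
  "immersed_path \<Gamma> arev u p v \<longleftrightarrow> pre_digraph.awalk \<Gamma> u p v \<and> reduced arev p"

text \<open>
  Every homotopy class of closed paths at \<open>v\<close> contains exactly one immersed path, so the fundamental
  group is realised on the immersed closed paths, with concatenation followed by reduction.
\<close>

definition fundamental_group ::
    "('v, 'e) pre_digraph \<Rightarrow> ('e \<Rightarrow> 'e) \<Rightarrow> 'v \<Rightarrow> 'e list monoid" where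
  "fundamental_group \<Gamma> arev v =
     \<lparr>carrier = {p. immersed_path \<Gamma> arev v p v}, monoid.mult = (\<lambda>p q. reduce arev (p @ q)), monoid.one = []\<rparr>"

definition unoriented_edges :: "('v, 'e) pre_digraph \<Rightarrow> ('e \<Rightarrow> 'e) \<Rightarrow> 'e set set" where
  "unoriented_edges \<Gamma> arev = (\<lambda>e. {e, arev e}) ` arcs \<Gamma>"

definition folded :: "('v, 'e) pre_digraph \<Rightarrow> ('e \<Rightarrow> letter) \<Rightarrow> bool" where
  "folded \<Gamma> s \<longleftrightarrow> (\<forall>v \<in> verts \<Gamma>. inj_on s (out_arcs \<Gamma> v))"

text \<open>
  Since the graphs are finite, nothing is lost by taking natural numbers as vertices and edges.
  The name \<open>connected\<close> is qualified to distinguish it from topological connectedness. A loop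
  contributes two outgoing arcs, hence \<open>out_degree\<close> is the usual degree of a vertex.
\<close>

definition readable :: "nat \<Rightarrow> real \<Rightarrow> word \<Rightarrow> bool" where
  "readable k \<mu> w \<longleftrightarrow> w \<in> freely_reduced k \<and>
     (\<exists>(\<Gamma> :: (nat, nat) pre_digraph) arev base s.
        fin_digraph \<Gamma> \<and> bidirected_digraph \<Gamma> arev \<and> Digraph_Component.connected \<Gamma> \<and>
        base \<in> verts \<Gamma> \<and>
        (\<forall>e \<in> arcs \<Gamma>. s e \<in> letters k \<and> s (arev e) = letter_inv (s e)) \<and>
        folded \<Gamma> s \<and>
        (\<forall>v \<in> verts \<Gamma>. v \<noteq> base \<longrightarrow> out_degree \<Gamma> v \<noteq> 1) \<and>
        (\<exists>r \<le> k - 1. free_of_rank (fundamental_group \<Gamma> arev base) r) \<and>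
        (\<exists>u p v. immersed_path \<Gamma> arev u p v \<and> map s p = w) \<and>
        real (card (unoriented_edges \<Gamma> arev)) \<le> \<mu> * real (length w))"


section \<open>Random properties of presentations\<close>

text \<open>
  A finite presentation on \<open>a\<^sub>1, \<dots>, a\<^sub>k\<close> is given by its list of defining relators. A property of
  finite presentations is a family \<open>G\<close>, where \<open>G k\<close> is a predicate on the lists of relators over
  \<open>a\<^sub>1, \<dots>, a\<^sub>k\<close>.
\<close>

type_synonym presentation_property = "nat \<Rightarrow> word list \<Rightarrow> bool"

definition num_words :: "nat \<Rightarrow> nat \<Rightarrow> nat" where
  "num_words n k = card {w \<in> cyclically_reduced k. length w = n}"

definition num_relators :: "nat \<Rightarrow> nat \<Rightarrow> real \<Rightarrow> nat" where
  "num_relators k n d = nat \<lfloor>real (2 * k - 1) powr (d * real n)\<rfloor>"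

definition num_presentations :: "nat \<Rightarrow> nat \<Rightarrow> real \<Rightarrow> (word list \<Rightarrow> bool) \<Rightarrow> nat" where
  "num_presentations k n d P =
     card {rs. length rs = num_relators k n d \<and>
               (\<forall>r \<in> set rs. r \<in> cyclically_reduced k \<and> length r = n) \<and> P rs}"

definition d_random :: "real \<Rightarrow> presentation_property \<Rightarrow> bool" where
  "d_random d G \<longleftrightarrow>
     (\<forall>k \<ge> 2. (\<lambda>n. real (num_presentations k n d (G k)) /
                    real (num_words n k) ^ num_relators k n d) \<longlonglongrightarrow> 1)"

definition non_readable :: "(nat \<Rightarrow> real) \<Rightarrow> presentation_property" where
  "non_readable \<mu> k rs \<longleftrightarrow> (\<forall>r \<in> set rs. \<not> readable k (\<mu> k) r)"

end

(* A word in a_1, ..., a_{k-1} is read along the rose with k-1 petals, whose number of edges does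
   not depend on the word. Already the positive words in these letters form a proportion of at
   least ((k-1)/(2k))^n >= 4^(-n) of the cyclically reduced words of length n. For k so large that
   (2k-1)^d >= 8, there are about 8^n or more relators, so the probability that all of them
   avoid the readable words does not tend to 1. *)
theory Submission
  imports Defs
begin

section \<open>Reduction under injective relabelling\<close>

lemma cancel_cons_map:
  assumes "inj f" and "f (bar x) = bar' (f x)"
  shows "cancel_cons bar' (f x) (map f ys) = map f (cancel_cons bar x ys)"
proof (cases ys)
  case (Cons y zs)
  have "f y = bar' (f x) \<longleftrightarrow> y = bar x"
    using assms by (metis injD)
  then show ?thesis
    by (simp add: Cons)
qed simp

text \<open>Commutation of \<open>f\<close> with the inversions is asked only on entries of the
  list, because \<open>rose_rev j\<close> agrees with letter inversion only on codes below
  \<open>2 * j\<close>.\<close>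

lemma reduce_map:
  assumes "inj f" and "\<And>x. x \<in> set xs \<Longrightarrow> f (bar x) = bar' (f x)"
  shows "reduce bar' (map f xs) = map f (reduce bar xs)"
  using assms(2)
proof (induction xs)
  case (Cons x xs)
  then show ?case
    using cancel_cons_map[OF assms(1), of bar x bar'] by (simp add: reduce_def)
qed (simp add: reduce_def)

lemma reduced_map:
  assumes "inj f" and "\<And>x. x \<in> set xs \<Longrightarrow> f (bar x) = bar' (f x)"
  shows "reduced bar' (map f xs) \<longleftrightarrow> reduced bar xs"
  unfolding reduced_def successively_map
proof (intro successively_cong)
  fix x y assume "x \<in> set xs"
  then have "bar' (f x) = f (bar x)"
    using assms(2) by simp
  then show "f y \<noteq> bar' (f x) \<longleftrightarrow> y \<noteq> bar x"
    using inj_eq[OF assms(1)] by simp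
qed auto


section \<open>The rose\<close>

text \<open>Graphs in \<open>readable\<close> have natural numbers as arcs. This bijection sends
  \<open>letters j\<close> onto \<open>{..<2 * j}\<close>, so arcs of the rose are letters in
  disguise.\<close>

fun letter_code :: "letter \<Rightarrow> nat" where
  "letter_code (i, b) = 2 * i + of_bool b"

definition code_letter :: "nat \<Rightarrow> letter" where
  "code_letter e = (e div 2, odd e)"

lemma code_letter_code [simp]: "code_letter (letter_code x) = x"
  by (cases x) (auto simp: code_letter_def)

lemma letter_code_letter [simp]: "letter_code (code_letter e) = e"
  by (auto simp: code_letter_def odd_two_times_div_two_succ)

lemma inj_letter_code: "inj letter_code"
  by (metis code_letter_code injI)

lemma letter_code_less_iff: "letter_code x < 2 * j \<longleftrightarrow> x \<in> letters j"
  by (cases x; cases "snd x") (auto simp: letters_def)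

declare letter_code.simps [simp del]

lemma letter_inv_letter_inv [simp]: "letter_inv (letter_inv x) = x"
  by (cases x) auto

lemma letter_inv_neq: "letter_inv x \<noteq> x"
  by (cases x) auto

lemma letter_inv_in_letters_iff [simp]: "letter_inv x \<in> letters j \<longleftrightarrow> x \<in> letters j"
  by (cases x) (auto simp: letters_def)

definition rose :: "nat \<Rightarrow> (nat, nat) pre_digraph" where
  "rose j = \<lparr>verts = {0}, arcs = {..<2 * j}, tail = (\<lambda>_. 0), head = (\<lambda>_. 0)\<rparr>"

text \<open>The identity beyond the arcs is forced: in \<open>bidirected_digraph\<close> the
  reversal moves exactly the arcs.\<close>

definition rose_rev :: "nat \<Rightarrow> nat \<Rightarrow> nat" where
  "rose_rev j e = (if e < 2 * j then letter_code (letter_inv (code_letter e)) else e)"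

lemma rose_rev_letter_code:
  "x \<in> letters j \<Longrightarrow> letter_code (letter_inv x) = rose_rev j (letter_code x)"
  by (simp add: rose_rev_def letter_code_less_iff)

lemma code_letter_in_letters_iff: "code_letter e \<in> letters j \<longleftrightarrow> e < 2 * j"
  by (simp flip: letter_code_less_iff)

lemma fin_digraph_rose: "fin_digraph (rose j)"
  by unfold_locales (auto simp: rose_def)

lemma bidirected_digraph_rose: "bidirected_digraph (rose j) (rose_rev j)"
proof -
  interpret fin_digraph "rose j" by (rule fin_digraph_rose)
  show ?thesis
  proof (rule bidirected_digraphI)
    fix e assume "e \<in> arcs (rose j)"
    then have "e < 2 * j" by (simp add: rose_def)
    then show "rose_rev j e \<noteq> e"
      by (metis code_letter_code letter_inv_neq rose_rev_def)
    from \<open>e < 2 * j\<close> show "rose_rev j (rose_rev j e) = e"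
      by (simp add: rose_rev_def letter_code_less_iff code_letter_in_letters_iff)
  qed (auto simp: rose_def rose_rev_def)
qed

lemma connected_rose: "Digraph_Component.connected (rose j)"
  by (auto simp: connected_def strongly_connected_def reachable_def rose_def mk_symmetric_def)

section \<open>Immersed paths in the rose and its fundamental group\<close>

lemma awalk_rose_iff:
  "pre_digraph.awalk (rose j) u p v \<longleftrightarrow> u = 0 \<and> v = 0 \<and> set p \<subseteq> {..<2 * j}"
proof -
  \<comment> \<open>All arcs are loops at the single vertex, so consecutive arcs always fit
    together.\<close>
  have "pre_digraph.cas (rose j) 0 p v \<longleftrightarrow> v = 0"
    by (induction p) (auto simp: pre_digraph.cas.simps rose_def)
  then show ?thesis
    by (auto simp: pre_digraph.awalk_def) (auto simp: rose_def)
qed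

lemma immersed_path_rose:
  assumes "w \<in> freely_reduced j"
  shows "immersed_path (rose j) (rose_rev j) 0 (map letter_code w) 0"
proof -
  have w: "set w \<subseteq> letters j" "reduced letter_inv w"
    using assms by (auto simp: freely_reduced_def)
  moreover have "reduced (rose_rev j) (map letter_code w) \<longleftrightarrow> reduced letter_inv w"
    using w(1) by (intro reduced_map inj_letter_code) (auto intro: rose_rev_letter_code)
  ultimately show ?thesis
    by (auto simp: immersed_path_def awalk_rose_iff letter_code_less_iff)
qed

lemma immersed_path_roseE:
  assumes "immersed_path (rose j) (rose_rev j) u p v"
  obtains w where "w \<in> freely_reduced j" and "p = map letter_code w"
proof
  define w where "w = map code_letter p"
  show p: "p = map letter_code w"
    by (simp add: w_def o_def)
  have "set w \<subseteq> letters j"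
    using assms by (auto simp: immersed_path_def awalk_rose_iff w_def code_letter_in_letters_iff)
  moreover from this have "reduced (rose_rev j) (map letter_code w) \<longleftrightarrow> reduced letter_inv w"
    by (intro reduced_map inj_letter_code) (auto intro: rose_rev_letter_code)
  ultimately show "w \<in> freely_reduced j"
    using assms by (auto simp: freely_reduced_def immersed_path_def simp flip: p)
qed

text \<open>Both groups multiply by concatenating and reducing, and relabelling letters as arcs
  respects this while matching reduced words with immersed closed paths.\<close>

lemma free_of_rank_rose: "free_of_rank (fundamental_group (rose j) (rose_rev j) 0) j"
proof -
  let ?F = "free_group j" and ?P = "fundamental_group (rose j) (rose_rev j) 0"
  have image: "map letter_code ` carrier ?F = carrier ?P"
    by (auto simp: free_group_def fundamental_group_def immersed_path_rose
        elim!: immersed_path_roseE)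
  have "map letter_code \<in> hom ?F ?P"
  proof (rule homI)
    fix u v assume "u \<in> carrier ?F" "v \<in> carrier ?F"
    then have "set (u @ v) \<subseteq> letters j"
      by (auto simp: free_group_def freely_reduced_def)
    then have "reduce (rose_rev j) (map letter_code (u @ v))
        = map letter_code (reduce letter_inv (u @ v))"
      by (intro reduce_map inj_letter_code) (auto intro: rose_rev_letter_code)
    then show "map letter_code (u \<otimes>\<^bsub>?F\<^esub> v) = map letter_code u \<otimes>\<^bsub>?P\<^esub> map letter_code v"
      by (simp add: free_group_def fundamental_group_def)
  qed (use image in blast)
  moreover have "inj_on (map letter_code) (carrier ?F)"
    using inj_mapI[OF inj_letter_code] by (rule inj_on_subset) simp
  ultimately have "map letter_code \<in> iso ?F ?P"
    using image by (auto simp: iso_def bij_betw_def)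
  then show ?thesis
    by (auto simp: free_of_rank_def is_iso_def)
qed

text \<open>Counting oriented edges loses a factor 2 against the exact value \<open>j\<close>; this
  is harmless, as the bound only has to be independent of the word.\<close>

lemma card_unoriented_edges_rose: "card (unoriented_edges (rose j) (rose_rev j)) \<le> 2 * j"
  unfolding unoriented_edges_def rose_def by (auto intro: card_image_le[THEN order_trans])

text \<open>The rose with \<open>k - 1\<close> petals has the largest rank that
  \<open>readable\<close> admits, and for positive \<open>\<mu>\<close> every sufficiently long word
  satisfies the length hypothesis.\<close>

lemma readable_if_fewer_letters:
  assumes w: "w \<in> freely_reduced (k - 1)" and "real (2 * (k - 1)) \<le> \<mu> * real (length w)"
  shows "readable k \<mu> w"
proof -
  define j where "j = k - 1"
  have sub: "letters j \<subseteq> letters k"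
    by (auto simp: letters_def j_def)
  have "w \<in> freely_reduced k"
    using w sub by (auto simp: freely_reduced_def j_def)
  moreover have "code_letter e \<in> letters k \<and>
      code_letter (rose_rev j e) = letter_inv (code_letter e)" if "e \<in> arcs (rose j)" for e
  proof -
    have "e < 2 * j"
      using that by (simp add: rose_def)
    then show ?thesis
      using sub code_letter_in_letters_iff[of e j] by (simp add: rose_rev_def subsetD)
  qed
  moreover have "folded (rose j) code_letter"
    unfolding folded_def by (metis inj_on_inverseI letter_code_letter)
  \<comment> \<open>The degree condition is vacuous, the base being the only vertex.\<close>
  moreover have "\<forall>v \<in> verts (rose j). v \<noteq> 0 \<longrightarrow> out_degree (rose j) v \<noteq> 1"
    and "0 \<in> verts (rose j)"
    by (auto simp: rose_def)
  moreover have "\<exists>r \<le> k - 1. free_of_rank (fundamental_group (rose j) (rose_rev j) 0) r"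
    using free_of_rank_rose j_def by blast
  moreover have "map code_letter (map letter_code w) = w"
    by (simp add: o_def)
  moreover have "immersed_path (rose j) (rose_rev j) 0 (map letter_code w) 0"
    using w by (simp add: immersed_path_rose j_def)
  moreover have "real (card (unoriented_edges (rose j) (rose_rev j))) \<le> \<mu> * real (length w)"
    using card_unoriented_edges_rose[of j] assms(2)
    unfolding j_def by (meson of_nat_mono order_trans)
  ultimately show ?thesis
    unfolding readable_def
    using fin_digraph_rose[of j] bidirected_digraph_rose[of j] connected_rose[of j] by blast
qed


section \<open>Counting\<close>

lemma card_letters: "card (letters k) = 2 * k"
  by (simp add: letters_def card_cartesian_product)

lemma finite_letters: "finite (letters k)"
  by (simp add: letters_def)

lemma finite_words_length: "finite {w \<in> cyclically_reduced k. length w = n}"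
  by (rule finite_subset[OF _ finite_lists_length_eq[OF finite_letters[of k], of n]])
    (auto simp: cyclically_reduced_def freely_reduced_def)

lemma num_words_le: "num_words n k \<le> (2 * k) ^ n"
proof -
  have "num_words n k \<le> card {w. set w \<subseteq> letters k \<and> length w = n}"
    unfolding num_words_def
    by (rule card_mono[OF finite_lists_length_eq[OF finite_letters]])
      (auto simp: cyclically_reduced_def freely_reduced_def)
  then show ?thesis
    by (simp add: card_lists_length_eq finite_letters card_letters)
qed

text \<open>Inverse letters have opposite signs, so neither adjacent letters nor the two ends of a
  positive word can cancel.\<close>

lemma positive_word_cyclically_reduced:
  assumes "set w \<subseteq> {..<j} \<times> {True}"
  shows "w \<in> cyclically_reduced j"
proof -
  have ne: "y \<noteq> letter_inv x" if "x \<in> set w" "y \<in> set w" for x y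
    using assms that by (cases x; cases y) auto
  \<comment> \<open>A trivial relation to start from: \<open>successively_mono\<close> then asks for
    \<open>ne\<close> on entries of \<open>w\<close> only.\<close>
  have "successively (\<lambda>x y. True) w"
    by (induction w rule: induct_list012) auto
  then have "reduced letter_inv w"
    unfolding reduced_def by (rule successively_mono) (use ne in auto)
  then show ?thesis
    using assms ne by (auto simp: cyclically_reduced_def freely_reduced_def letters_def)
qed

lemma cyclically_reduced_mono:
  assumes "j \<le> k"
  shows "cyclically_reduced j \<subseteq> cyclically_reduced k"
proof -
  have "letters j \<subseteq> letters k"
    using assms by (auto simp: letters_def)
  then show ?thesis
    by (auto simp: cyclically_reduced_def freely_reduced_def)
qed

text \<open>Restricting to positive words makes the count a plain power, since their letters can be
  chosen independently.\<close>

lemma card_readable_ge: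
  assumes "real (2 * (k - 1)) \<le> \<mu> * real n"
  shows "(k - 1) ^ n \<le> card {w \<in> cyclically_reduced k. length w = n \<and> readable k \<mu> w}"
proof -
  let ?S = "{..<k - 1} \<times> {True}"
  have "{w. set w \<subseteq> ?S \<and> length w = n}
      \<subseteq> {w \<in> cyclically_reduced k. length w = n \<and> readable k \<mu> w}"
  proof clarify
    fix w :: word assume w: "set w \<subseteq> ?S" "n = length w"
    then have "w \<in> cyclically_reduced (k - 1)"
      by (intro positive_word_cyclically_reduced)
    then show "w \<in> cyclically_reduced k \<and> length w = length w \<and> readable k \<mu> w"
      using assms cyclically_reduced_mono[of "k - 1" k] w(2)
      by (auto intro: readable_if_fewer_letters simp: cyclically_reduced_def)
  qed
  then have "card {w. set w \<subseteq> ?S \<and> length w = n}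
      \<le> card {w \<in> cyclically_reduced k. length w = n \<and> readable k \<mu> w}"
    by (rule card_mono[rotated]) (rule finite_subset[OF _ finite_words_length[of k n]], auto)
  then show ?thesis
    by (simp add: card_lists_length_eq card_cartesian_product)
qed

section \<open>The probability that every relator is non-readable\<close>

lemma num_presentations_Ball:
  "num_presentations k n d (\<lambda>rs. \<forall>r \<in> set rs. Q r)
    = card {w \<in> cyclically_reduced k. length w = n \<and> Q w} ^ num_relators k n d"
proof -
  let ?A = "{w \<in> cyclically_reduced k. length w = n \<and> Q w}"
  have "finite ?A"
    by (rule finite_subset[OF _ finite_words_length[of k n]]) auto
  then have "card {rs. set rs \<subseteq> ?A \<and> length rs = num_relators k n d}
      = card ?A ^ num_relators k n d"
    by (rule card_lists_length_eq)
  \<comment> \<open>The condition concerns each relator separately, so the admissible tuples are all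
    lists over \<open>?A\<close>.\<close>
  moreover have "{rs. set rs \<subseteq> ?A \<and> length rs = num_relators k n d}
      = {rs. length rs = num_relators k n d \<and>
          (\<forall>r \<in> set rs. r \<in> cyclically_reduced k \<and> length r = n) \<and> (\<forall>r \<in> set rs. Q r)}"
    by auto
  ultimately show ?thesis
    by (simp add: num_presentations_def)
qed

lemma num_words_split:
  "num_words n k = card {w \<in> cyclically_reduced k. length w = n \<and> Q w}
    + card {w \<in> cyclically_reduced k. length w = n \<and> \<not> Q w}"
proof -
  have fin: "finite {w \<in> cyclically_reduced k. length w = n \<and> R w}" for R
    by (rule finite_subset[OF _ finite_words_length[of k n]]) auto
  show ?thesis
    unfolding num_words_def
    by (subst card_Un_disjoint[OF fin fin, symmetric]) (auto intro: arg_cong[of _ _ card])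
qed

text \<open>If \<open>p\<close> is the proportion of readable words and \<open>m\<close> the number
  of relators, the ratio is \<open>(1 - p) ^ m\<close>, at most \<open>exp (- (m * p))\<close>; the
  hypotheses give \<open>m * p\<close> at least 1.\<close>

lemma non_readable_ratio_le:
  assumes "k \<ge> 2" and "real (2 * (k - 1)) \<le> \<mu> k * real n"
    and m: "4 ^ n \<le> num_relators k n d"
  shows "real (num_presentations k n d (non_readable \<mu> k)) / real (num_words n k) ^ num_relators k n d
    \<le> exp (- 1)"
proof -
  define N where "N = real (num_words n k)"
  define B where "B = real (card {w \<in> cyclically_reduced k. length w = n \<and> readable k (\<mu> k) w})"
  define A where "A = real (card {w \<in> cyclically_reduced k. length w = n \<and> \<not> readable k (\<mu> k) w})"
  define m where "m = num_relators k n d"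
  have "num_presentations k n d (non_readable \<mu> k)
      = card {w \<in> cyclically_reduced k. length w = n \<and> \<not> readable k (\<mu> k) w} ^ m"
    using num_presentations_Ball[of k n d "\<lambda>r. \<not> readable k (\<mu> k) r"]
    unfolding non_readable_def m_def .
  then have num: "real (num_presentations k n d (non_readable \<mu> k)) = A ^ m"
    by (simp add: A_def)
  have N: "N = B + A"
    using num_words_split[of n k "readable k (\<mu> k)"] by (simp add: N_def A_def B_def)
  have B: "real (k - 1) ^ n \<le> B"
    using card_readable_ge[OF assms(2)] unfolding B_def
    by (metis of_nat_le_iff of_nat_power)
  have "0 < real (k - 1) ^ n"
    using assms(1) by simp
  then have "0 < B" using B by linarith
  have "A \<ge> 0" by (simp add: A_def)
  then have "0 < N" using N \<open>0 < B\<close> by linarith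
  have "N \<le> real (2 * k) ^ n"
    using num_words_le[of n k] unfolding N_def by (metis of_nat_le_iff of_nat_power)
  \<comment> \<open>The base 4 in the hypothesis on \<open>num_relators\<close> comes from here:
    \<open>2 * k\<close> is at most \<open>4 * (k - 1)\<close> once \<open>k\<close> is at least
    2.\<close>
  also have "\<dots> \<le> (4 * real (k - 1)) ^ n"
    using assms(1) by (intro power_mono) auto
  also have "\<dots> = 4 ^ n * real (k - 1) ^ n"
    by (rule power_mult_distrib)
  also have "\<dots> \<le> real m * B"
  proof (rule mult_mono)
    have "real (4 ^ n) \<le> real m"
      using m unfolding m_def by (rule of_nat_mono)
    then show "4 ^ n \<le> real m" by simp
  qed (use B in auto)
  finally have p: "1 \<le> real m * (B / N)"
    using \<open>0 < N\<close> by (simp add: field_simps)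
  have "A / N = 1 + - (B / N)"
    using N \<open>0 < N\<close> by (simp add: field_simps)
  also have "\<dots> \<le> exp (- (B / N))"
    by (rule exp_ge_add_one_self)
  finally have "(A / N) ^ m \<le> exp (- (B / N)) ^ m"
    using \<open>A \<ge> 0\<close> \<open>0 < N\<close> by (intro power_mono) auto
  also have "\<dots> = exp (- (real m * (B / N)))"
    by (simp add: exp_of_nat_mult[symmetric])
  also have "\<dots> \<le> exp (- 1)"
    using p by simp
  finally show ?thesis
    by (simp add: num power_divide flip: m_def N_def)
qed

section \<open>Many generators give enough relators, and the limit argument\<close>

lemma num_relators_ge:
  assumes "8 \<le> real (2 * k - 1) powr d"
  shows "4 ^ n \<le> num_relators k n d"
proof -
  have "(4::real) ^ n \<le> 8 ^ n"
    by (rule power_mono) auto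
  also have "\<dots> \<le> (real (2 * k - 1) powr d) ^ n"
    using assms by (intro power_mono) auto
  also have "\<dots> = real (2 * k - 1) powr (d * real n)"
    by (subst powr_realpow[symmetric]) (use assms in \<open>auto simp: powr_powr\<close>)
  finally show ?thesis
    \<comment> \<open>Rounding down costs nothing, because \<open>4 ^ n\<close> is an
      integer.\<close>
    unfolding num_relators_def by (intro le_nat_floor) simp
qed

theorem corollary6p2:
  fixes \<mu> :: "nat \<Rightarrow> real" and d :: real
  assumes "\<And>k. k \<ge> 2 \<Longrightarrow> 0 < \<mu> k \<and> \<mu> k < 1"
    and "0 < d" and "d < 1"
  shows "\<not> d_random d (non_readable \<mu>)"
proof
  assume random: "d_random d (non_readable \<mu>)"
  \<comment> \<open>One bad \<open>k\<close> suffices, since \<open>d_random\<close> quantifies over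
    all of them. The first summand makes \<open>(2 * k - 1) powr d\<close> at least 8, and the 2
    ensures that \<open>k\<close> is at least 2.\<close>
  obtain k :: nat where k: "8 powr (1 / d) + 2 \<le> real k"
    using real_arch_simple by blast
  have "0 \<le> 8 powr (1 / d)" by simp
  with k have "k \<ge> 2" by linarith
  have "8 = (8 powr (1 / d)) powr d"
    using \<open>0 < d\<close> by (simp add: powr_powr)
  also have "\<dots> \<le> real (2 * k - 1) powr d"
    using k \<open>k \<ge> 2\<close> \<open>0 < d\<close> by (intro powr_mono2) auto
  finally have m: "4 ^ n \<le> num_relators k n d" for n
    by (rule num_relators_ge)
  let ?ratio = "\<lambda>n. real (num_presentations k n d (non_readable \<mu> k))
    / real (num_words n k) ^ num_relators k n d"
  \<comment> \<open>From this length on, the fixed rose fits within the allowed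
    \<open>\<mu> k * n\<close> edges.\<close>
  obtain n0 :: nat where n0: "real (2 * (k - 1)) / \<mu> k \<le> real n0"
    using real_arch_simple by blast
  have "?ratio n \<le> exp (- 1)" if "n \<ge> n0" for n
  proof (rule non_readable_ratio_le[OF \<open>k \<ge> 2\<close> _ m])
    have "real (2 * (k - 1)) / \<mu> k \<le> real n"
      using n0 that by linarith
    then show "real (2 * (k - 1)) \<le> \<mu> k * real n"
      using assms(1)[OF \<open>k \<ge> 2\<close>] by (simp add: field_simps)
  qed
  moreover have "?ratio \<longlonglongrightarrow> 1"
    using random \<open>k \<ge> 2\<close> unfolding d_random_def by blast
  \<comment> \<open>An eventual upper bound passes to the limit.\<close>
  ultimately have "1 \<le> exp (- 1 :: real)"
    by (intro LIMSEQ_le_const2) auto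
  then show False by simp
qed

end
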